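(* Let $p(\vartheta,x)$ be a joint probability density of $(\vartheta,x)\in\mathbf{\Theta}\times\mathbf{X}$ with marginal densities $p(\vartheta)$ and $p(x)$, and let $d(\vartheta,x)=\dfrac{p(\vartheta,x)}{p(\vartheta,x)+p(\vartheta)p(x)}$. Let $\hat d:\mathbf{\Theta}\times\mathbf{X}\to[0,1]$ be any (measurable) classifier that is balanced, i.e. $$\mathbb{E}_{p(\vartheta,x)}\left[\hat d(\vartheta,x)\right]+\mathbb{E}_{p(\vartheta)p(x)}\left[\hat d(\vartheta,x)\right]=1.$$ Then $$\mathbb{E}_{p(\vartheta,x)}\left[\frac{d(\vartheta,x)}{\hat d(\vartheta,x)}\right]\ge 1.$$
   Context: $\mathbf{\Theta}$ (parameter space) and $\mathbf{X}$ (observation space) are measurable spaces equipped with $\sigma$-finite reference measures (e.g. Lebesgue measure on Euclidean spaces), written $\mathrm{d}\vartheta$ and $\mathrm{d}x$. $p(\vartheta,x)$ is a probability density with respect to the product reference measure, and $p(\vartheta)=\int p(\vartheta,x)\,\mathrm{d}x$, $p(x)=\int p(\vartheta,x)\,\mathrm{d}\vartheta$ are its marginals. For a function $g$, $\mathbb{E}_{p(\vartheta,x)}[g]=\iint g(\vartheta,x)\,p(\vartheta,x)\,\mathrm{d}\vartheta\,\mathrm{d}x$ and $\mathbb{E}_{p(\vartheta)p(x)}[g]=\iint g(\vartheta,x)\,p(\vartheta)p(x)\,\mathrm{d}\vartheta\,\mathrm{d}x$. The function $d$ (the Bayes optimal classifier for distinguishing samples of $p(\vartheta,x)$, label 1,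 from samples of $p(\vartheta)p(x)$, label 0) is defined by its formula wherever the denominator is positive; its values elsewhere are irrelevant, since both $p(\vartheta,x)$ and $p(\vartheta)p(x)$ vanish there. The expectation in the conclusion is of a nonnegative function and takes values in $[0,+\infty]$, with the convention $a/0=+\infty$ for $a>0$. *)

theory Defs
  imports "HOL-Probability.Probability"
begin

text \<open>
  The measures \<open>M\<close> on the parameter space and \<open>N\<close> on the observation space are the reference
  measures. Every integrand below is nonnegative, so all integrals are nonnegative Lebesgue
  integrals with values in \<^typ>\<open>ennreal\<close>; no integrability side conditions arise.
\<close>

definition prob_density :: "'c measure \<Rightarrow> ('c \<Rightarrow> real) \<Rightarrow> bool" where
  "prob_density K p \<longleftrightarrow>
     p \<in> borel_measurable K \<and> (\<forall>z \<in> space K. 0 \<le> p z) \<and> (\<integral>\<^sup>+ z. ennreal (p z) \<partial>K) = 1"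

text \<open>
  For a probability density the marginals are finite almost everywhere; the value \<open>\<infinity>\<close> can occur
  only on a null set of the respective reference measure.
\<close>

definition marginal_param :: "'b measure \<Rightarrow> ('a \<times> 'b \<Rightarrow> real) \<Rightarrow> 'a \<Rightarrow> ennreal" where
  "marginal_param N p \<theta> = (\<integral>\<^sup>+ x. ennreal (p (\<theta>, x)) \<partial>N)"

definition marginal_obs :: "'a measure \<Rightarrow> ('a \<times> 'b \<Rightarrow> real) \<Rightarrow> 'b \<Rightarrow> ennreal" where
  "marginal_obs M p x = (\<integral>\<^sup>+ \<theta>. ennreal (p (\<theta>, x)) \<partial>M)"

definition marginal_prod ::
    "'a measure \<Rightarrow> 'b measure \<Rightarrow> ('a \<times> 'b \<Rightarrow> real) \<Rightarrow> 'a \<times> 'b \<Rightarrow> ennreal" where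
  "marginal_prod M N p = (\<lambda>(\<theta>, x). marginal_param N p \<theta> * marginal_obs M p x)"

definition expect_joint ::
    "'a measure \<Rightarrow> 'b measure \<Rightarrow> ('a \<times> 'b \<Rightarrow> real) \<Rightarrow> ('a \<times> 'b \<Rightarrow> ennreal) \<Rightarrow> ennreal" where
  "expect_joint M N p g = (\<integral>\<^sup>+ z. g z * ennreal (p z) \<partial>(M \<Otimes>\<^sub>M N))"

definition expect_marginals ::
    "'a measure \<Rightarrow> 'b measure \<Rightarrow> ('a \<times> 'b \<Rightarrow> real) \<Rightarrow> ('a \<times> 'b \<Rightarrow> ennreal) \<Rightarrow> ennreal" where
  "expect_marginals M N p g = (\<integral>\<^sup>+ z. g z * marginal_prod M N p z \<partial>(M \<Otimes>\<^sub>M N))"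

text \<open>
  Division on \<^typ>\<open>ennreal\<close> satisfies \<open>a / 0 = \<infinity>\<close> for \<open>a > 0\<close> and \<open>0 / 0 = 0\<close>. The latter gives
  \<open>bayes_classifier\<close> the value \<open>0\<close> where its denominator vanishes, and there the joint density and
  the product of the marginals are both zero.
\<close>

definition bayes_classifier ::
    "'a measure \<Rightarrow> 'b measure \<Rightarrow> ('a \<times> 'b \<Rightarrow> real) \<Rightarrow> 'a \<times> 'b \<Rightarrow> ennreal" where
  "bayes_classifier M N p z = ennreal (p z) / (ennreal (p z) + marginal_prod M N p z)"

definition balanced ::
    "'a measure \<Rightarrow> 'b measure \<Rightarrow> ('a \<times> 'b \<Rightarrow> real) \<Rightarrow> ('a \<times> 'b \<Rightarrow> real) \<Rightarrow> bool" where
  "balanced M N p c \<longleftrightarrow>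
     expect_joint M N p (\<lambda>z. ennreal (c z)) + expect_marginals M N p (\<lambda>z. ennreal (c z)) = 1"

end

(* Write s = p + q with q the product of the marginals, so that balance says that s * dhat
   integrates to 1. By AM-GM, p^2 / (s * dhat) + s * dhat \<ge> 2 * p wherever q is finite, which is
   almost everywhere; integrating gives E[d / dhat] + 1 \<ge> 2. *)

theory Submission imports Defs
begin

text \<open>This is \<open>(a - b)\<^sup>2 \<ge> 0\<close> divided by \<open>b\<close>, with
  equality at \<open>a = b\<close>. It is proved over the reals, where subtraction and cancellation
  behave, and only then lifted to \<open>ennreal\<close>.\<close>

lemma divide_add_self_ennreal_ge:
  fixes a b :: real
  assumes "0 < a" "0 < b"
  shows "ennreal (2 * a) \<le> ennreal (a * a / b) + ennreal b"
proof -
  have "2 * a * b \<le> a * a + b * b"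
    using zero_le_power2[of "a - b"] by (simp add: power2_eq_square algebra_simps)
  then have "2 * a \<le> a * a / b + b"
    using assms by (simp add: field_simps)
  then show ?thesis
    using assms by (simp flip: ennreal_plus add: ennreal_leI)
qed

text \<open>The pointwise inequality to be integrated, with \<open>c\<close> standing for the value
  of \<open>dhat\<close>. Finiteness of \<open>q\<close> matters: for \<open>q = \<infinity>\<close>
  and \<open>c = 0\<close> the right-hand side is 0, whatever \<open>p\<close> is.\<close>

lemma tangent_bound_ennreal:
  fixes p c :: real and q :: ennreal
  assumes "0 \<le> p" "0 \<le> c" "q \<noteq> \<infinity>"
  shows "2 * ennreal p \<le>
    ennreal p / (ennreal p + q) / ennreal c * ennreal p + (ennreal c * ennreal p + ennreal c * q)"
proof -
  obtain r where q: "q = ennreal r" "0 \<le> r"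
    using assms(3) by (cases q) auto
  consider "p = 0" | "p > 0" "c = 0" | "p > 0" "c > 0"
    using assms by linarith
  then show ?thesis
  proof cases
    case 1
    then show ?thesis by simp
  next
    case 2
    \<comment> \<open>A positive number divided by \<open>ennreal 0\<close> is \<infinity>, and
      multiplying by \<open>p > 0\<close> keeps it so; hence the right-hand side is
      infinite.\<close>
    then have "0 < ennreal p / (ennreal p + q)"
      using q by (simp add: divide_ennreal flip: ennreal_plus)
    then show ?thesis
      using 2 q by (simp add: ennreal_top_mult)
  next
    case 3
    \<comment> \<open>The weight is \<open>b = c * (p + r)\<close>, the integrand of the balance
      condition; dividing \<open>p * p\<close> by it produces the Bayes classifier over
      \<open>c\<close>, times \<open>p\<close>.\<close>
    have "ennreal (2 * p) \<le> ennreal (p * p / (c * (p + r))) + ennreal (c * (p + r))"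
      using 3 q by (intro divide_add_self_ennreal_ge) auto
    also have "ennreal (p * p / (c * (p + r))) = ennreal p / (ennreal p + q) / ennreal c * ennreal p"
      using 3 q by (simp add: divide_ennreal mult.commute flip: ennreal_plus ennreal_mult)
    also have "ennreal (c * (p + r)) = ennreal c * ennreal p + ennreal c * q"
      using 3 q by (simp add: distrib_left ennreal_mult)
    finally show ?thesis
      using 3 by (simp add: ennreal_mult)
  qed
qed

lemma borel_measurable_marginals:
  assumes "sigma_finite_measure M" "sigma_finite_measure N"
    and "p \<in> borel_measurable (M \<Otimes>\<^sub>M N)"
  shows "marginal_param N p \<in> borel_measurable M" "marginal_obs M p \<in> borel_measurable N"
    and "marginal_prod M N p \<in> borel_measurable (M \<Otimes>\<^sub>M N)"
proof -
  interpret M: sigma_finite_measure M by fact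
  interpret N: sigma_finite_measure N by fact
  note [measurable] = assms(3)
  show [measurable]: "marginal_param N p \<in> borel_measurable M"
    unfolding marginal_param_def by measurable
  show [measurable]: "marginal_obs M p \<in> borel_measurable N"
    unfolding marginal_obs_def by measurable
  show "marginal_prod M N p \<in> borel_measurable (M \<Otimes>\<^sub>M N)"
    unfolding marginal_prod_def by measurable
qed

text \<open>By Tonelli each marginal inherits total mass 1 from \<open>p\<close>, and the integral
  of the product factorises. Its purpose is to make the product of the marginals finite almost
  everywhere.\<close>

lemma nn_integral_marginal_prod:
  assumes "sigma_finite_measure M" "sigma_finite_measure N" "prob_density (M \<Otimes>\<^sub>M N) p"
  shows "(\<integral>\<^sup>+ z. marginal_prod M N p z \<partial>(M \<Otimes>\<^sub>M N)) = 1"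
proof -
  interpret pair_sigma_finite M N
    using assms by (simp add: pair_sigma_finite_def)
  have p [measurable]: "p \<in> borel_measurable (M \<Otimes>\<^sub>M N)"
    and one: "(\<integral>\<^sup>+ z. ennreal (p z) \<partial>(M \<Otimes>\<^sub>M N)) = 1"
    using assms(3) by (auto simp: prob_density_def)
  note [measurable] = borel_measurable_marginals[OF assms(1,2) p]
  have "(\<integral>\<^sup>+ \<theta>. marginal_param N p \<theta> \<partial>M) = 1"
    unfolding marginal_param_def using M2.nn_integral_fst[of "\<lambda>z. ennreal (p z)" M] one by simp
  moreover have "(\<integral>\<^sup>+ x. marginal_obs M p x \<partial>N) = 1"
    unfolding marginal_obs_def using nn_integral_snd[of "\<lambda>z. ennreal (p z)"] one by simp
  ultimately have "(\<integral>\<^sup>+ \<theta>. \<integral>\<^sup>+ x. marginal_prod M N p (\<theta>, x) \<partial>N \<partial>M) = 1"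
    by (simp add: marginal_prod_def nn_integral_cmult)
  then show ?thesis
    by (simp add: M2.nn_integral_fst)
qed

theorem theorem1:
  fixes M :: "'a measure" and N :: "'b measure"
    and p :: "'a \<times> 'b \<Rightarrow> real" and dhat :: "'a \<times> 'b \<Rightarrow> real"
  assumes "sigma_finite_measure M" and "sigma_finite_measure N"
    and "prob_density (M \<Otimes>\<^sub>M N) p"
    and "dhat \<in> borel_measurable (M \<Otimes>\<^sub>M N)"
    and "\<And>z. z \<in> space (M \<Otimes>\<^sub>M N) \<Longrightarrow> dhat z \<in> {0..1}"
    and "balanced M N p dhat"
  shows "expect_joint M N p (\<lambda>z. bayes_classifier M N p z / ennreal (dhat z)) \<ge> 1"
proof -
  let ?K = "M \<Otimes>\<^sub>M N" and ?q = "marginal_prod M N p"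
  let ?E = "expect_joint M N p (\<lambda>z. bayes_classifier M N p z / ennreal (dhat z))"
  have p [measurable]: "p \<in> borel_measurable ?K" and nonneg: "\<And>z. z \<in> space ?K \<Longrightarrow> 0 \<le> p z"
    and one: "(\<integral>\<^sup>+ z. ennreal (p z) \<partial>?K) = 1"
    using assms(3) by (auto simp: prob_density_def)
  have q [measurable]: "?q \<in> borel_measurable ?K"
    by (rule borel_measurable_marginals[OF assms(1,2) p])
  note [measurable] = assms(4)
  \<comment> \<open>A nonnegative function with finite integral is infinite only on a null set, so
    the pointwise bound is available almost everywhere.\<close>
  have "AE z in ?K. ?q z \<noteq> \<infinity>"
    by (rule nn_integral_PInf_AE[OF q]) (simp add: nn_integral_marginal_prod[OF assms(1-3)])
  then have "AE z in ?K. 2 * ennreal (p z) \<le>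
      bayes_classifier M N p z / ennreal (dhat z) * ennreal (p z)
        + (ennreal (dhat z) * ennreal (p z) + ennreal (dhat z) * ?q z)"
  proof (rule AE_mp, intro AE_I2 impI)
    fix z assume "z \<in> space ?K" "?q z \<noteq> \<infinity>"
    then show "2 * ennreal (p z) \<le> bayes_classifier M N p z / ennreal (dhat z) * ennreal (p z)
        + (ennreal (dhat z) * ennreal (p z) + ennreal (dhat z) * ?q z)"
      unfolding bayes_classifier_def
      using nonneg assms(5)[of z] by (intro tangent_bound_ennreal) auto
  qed
  then have "(\<integral>\<^sup>+ z. 2 * ennreal (p z) \<partial>?K) \<le>
      (\<integral>\<^sup>+ z. bayes_classifier M N p z / ennreal (dhat z) * ennreal (p z)
        + (ennreal (dhat z) * ennreal (p z) + ennreal (dhat z) * ?q z) \<partial>?K)"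
    by (rule nn_integral_mono_AE)
  \<comment> \<open>Additivity, which rests on measurability of the summands, separates the target
    expectation from the two terms whose sum is fixed by balance.\<close>
  also have "\<dots> = ?E + (expect_joint M N p (\<lambda>z. ennreal (dhat z))
      + expect_marginals M N p (\<lambda>z. ennreal (dhat z)))"
    unfolding expect_joint_def expect_marginals_def bayes_classifier_def
    by (simp add: nn_integral_add)
  also have "\<dots> = ?E + 1"
    using assms(6) by (simp add: balanced_def)
  finally have "1 + 1 \<le> ?E + 1"
    by (simp add: nn_integral_cmult one)
  \<comment> \<open>The summand 1 is finite, so it cancels in \<open>ennreal\<close>. Dropping
    \<open>one_add_one\<close> keeps \<open>1 + 1\<close> from collapsing to 2, which would hide the
    common summand.\<close>
  then show ?thesis
    by (simp del: one_add_one)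
qed

end
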